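(* Let $(\mathbb{Z}, X, 0)$ be an expansive pointed $\mathbb{Z}$-dynamical system with metric $d$ such that for each homoclinic point $x \in X$ and all $\epsilon > 0$, there exist two points $x^1, x^2 \in X$ such that for each $i \in \{1, 2\}$ and $n \in \mathbb{Z}$ there exists $k \in \mathbb{Z}$ with $d(n \cdot x^i, k \cdot x) < \epsilon$, where moreover $k = 0$ can be chosen for infinitely many positive $n$ when $i = 1$ (that is, $d(n\cdot x^1, x)<\epsilon$ for infinitely many $n>0$), and for infinitely many negative $n$ when $i = 2$ (that is, $d(n\cdot x^2,x)<\epsilon$ for infinitely many $n<0$). Then every asymptotically nilpotent endomorphism $f : X \to X$ is nilpotent.
   Context: A pointed $\mathbb{Z}$-dynamical system $(\mathbb{Z},X,0)$ consists of a compact metric space $(X,d)$, a continuous action of $\mathbb{Z}$ on $X$ (written $n\cdot x$), and a point $0 \in X$ with $n\cdot 0 = 0$ for all $n\in\mathbb{Z}$. It is expansive if there is $0<\Delta\le 1$ such that $d(n\cdot x, n\cdot y)\le \Delta$ for all $n\in\mathbb{Z}$ implies $x=y$. A point $x \in X$ is homoclinic if for every $\epsilon>0$ there is a finite $E\subseteq \mathbb{Z}$ with $d(n\cdot x,0)<\epsilon$ for all $n\in\mathbb{Z}\setminus E$. An endomorphism is a continuous map $f:X\to X$ with $f(0)=0$ and $f(n\cdot x)=n\cdot f(x)$ for all $n\in\mathbb{Z}$, $x\in X$. It is asymptotically nilpotent if $\lim_{m\to\infty}f^m(x)=0$ for all $x\in X$, and nilpotent if $f^m(X)=\{0\}$ for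 some $m\in\mathbb{N}$. *)

theory Defs
  imports "HOL-Analysis.Analysis"
begin

text \<open>The space is a compact subset \<open>X\<close> of a metric type, with the restricted distance; maps are
  constrained only on \<open>X\<close>. The action is \<open>act n x\<close> and the distinguished point is \<open>o\<^sub>X\<close>.\<close>

definition pointed_Z_system :: "'a::metric_space set \<Rightarrow> (int \<Rightarrow> 'a \<Rightarrow> 'a) \<Rightarrow> 'a \<Rightarrow> bool" where
  "pointed_Z_system X act o\<^sub>X \<longleftrightarrow>
     compact X \<and>
     (\<forall>n. act n ` X \<subseteq> X) \<and>
     (\<forall>x\<in>X. act 0 x = x) \<and>
     (\<forall>m n. \<forall>x\<in>X. act (m + n) x = act m (act n x)) \<and>
     (\<forall>n. continuous_on X (act n)) \<and>
     o\<^sub>X \<in> X \<and> (\<forall>n. act n o\<^sub>X = o\<^sub>X)"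

definition expansive :: "'a::metric_space set \<Rightarrow> (int \<Rightarrow> 'a \<Rightarrow> 'a) \<Rightarrow> bool" where
  "expansive X act \<longleftrightarrow>
     (\<exists>\<Delta>. 0 < \<Delta> \<and> \<Delta> \<le> 1 \<and>
        (\<forall>x\<in>X. \<forall>y\<in>X. (\<forall>n. dist (act n x) (act n y) \<le> \<Delta>) \<longrightarrow> x = y))"

definition homoclinic :: "'a::metric_space set \<Rightarrow> (int \<Rightarrow> 'a \<Rightarrow> 'a) \<Rightarrow> 'a \<Rightarrow> 'a \<Rightarrow> bool" where
  "homoclinic X act o\<^sub>X x \<longleftrightarrow>
     x \<in> X \<and> (\<forall>\<epsilon>>0. \<exists>E. finite E \<and> (\<forall>n. n \<notin> E \<longrightarrow> dist (act n x) o\<^sub>X < \<epsilon>))"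

definition endomorphism ::
  "'a::metric_space set \<Rightarrow> (int \<Rightarrow> 'a \<Rightarrow> 'a) \<Rightarrow> 'a \<Rightarrow> ('a \<Rightarrow> 'a) \<Rightarrow> bool" where
  "endomorphism X act o\<^sub>X f \<longleftrightarrow>
     f ` X \<subseteq> X \<and> continuous_on X f \<and> f o\<^sub>X = o\<^sub>X \<and>
     (\<forall>n. \<forall>x\<in>X. f (act n x) = act n (f x))"

definition asymptotically_nilpotent :: "'a::metric_space set \<Rightarrow> 'a \<Rightarrow> ('a \<Rightarrow> 'a) \<Rightarrow> bool" where
  "asymptotically_nilpotent X o\<^sub>X f \<longleftrightarrow> (\<forall>x\<in>X. (\<lambda>m. (f ^^ m) x) \<longlonglongrightarrow> o\<^sub>X)"

definition nilpotent :: "'a set \<Rightarrow> 'a \<Rightarrow> ('a \<Rightarrow> 'a) \<Rightarrow> bool" where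
  "nilpotent X o\<^sub>X f \<longleftrightarrow> (\<exists>m::nat. (f ^^ m) ` X = {o\<^sub>X})"

end

theory Submission
  imports Defs
begin

text \<open> Think of \<open>x\<close> as a biinfinite word whose cell \<open>n\<close> at time \<open>t\<close> is \<open>n \<cdot> f\<^sup>t x\<close>, and call
that cell live when its distance from the fixed point is at least half the expansivity
constant. Expansivity makes live cells spread at bounded speed (\<open>radius_ex\<close>), and asymptotic
nilpotency together with compactness empties every window of given length within a time that
depends on the length only (\<open>quiet_time_ex\<close>). If \<open>f\<close> is not nilpotent, a glider can be
extracted: a nonzero homoclinic \<open>g\<close> with \<open>f\<^sup>p g = q \<cdot> g\<close> and \<open>p > 0\<close>.

The extraction rests on walls, positions around which all cells are dead from some time on. By
Zorn's lemma there is a minimal closed invariant set \<open>Y\<close> on which \<open>f\<close> is not nilpotent. Baire's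
theorem gives a relatively open \<open>U \<subseteq> Y\<close> all of whose points develop a wall at cell 0 after one
common time; the points of \<open>Y\<close> whose orbit misses \<open>U\<close> form a smaller invariant set, on which
\<open>f\<close> is nilpotent. Since \<open>f\<close> maps \<open>Y\<close> onto itself, every live cell in \<open>Y\<close> is therefore followed,
at bounded distance and after bounded time, by a wall (\<open>walls_ex\<close>). Now follow a live cell
backwards in time to obtain a long path of live cells. It leaves walls behind at every step and
cannot cross them, and whatever is caught between two walls dies. So the path travels in one
direction, what it leaves behind dies, and any activity further ahead of it than a fixed margin
would trap it. In the middle of its life the path carries an isolated cluster of bounded width
(\<open>isolated\<close>). A limit of such clusters is homoclinic and so are all its images, with a common
bound on their width; expansivity allows only finitely many points of that width up to
translation, so two images agree up to translation and a glider appears (\<open>glider_ex\<close>).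

Finally apply the gluing hypothesis to \<open>g\<close>. A point \<open>x\<close> that is locally everywhere close to the
orbit of \<open>g\<close> satisfies \<open>f\<^sup>p x = q \<cdot> x\<close> exactly, by expansivity (\<open>fellow_traveller\<close>). Asymptotic
nilpotency then sends \<open>n \<cdot> x\<close> to the fixed point as \<open>n\<close> goes to infinity in the direction of
\<open>q\<close>, but \<open>x\<close> can be chosen to return close to \<open>g\<close> infinitely often in that direction. \<close>

section \<open>Compactness and category in metric spaces\<close>

lemma Inter_chain_nonempty:
  fixes \<F> :: "'a::t2_space set set"
  assumes "\<F> \<noteq> {}" and comp: "\<And>S. S \<in> \<F> \<Longrightarrow> compact S" and ne: "{} \<notin> \<F>"
    and chain: "\<And>S T. S \<in> \<F> \<Longrightarrow> T \<in> \<F> \<Longrightarrow> S \<subseteq> T \<or> T \<subseteq> S"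
  shows "\<Inter>\<F> \<noteq> {}"
proof -
  obtain B where B: "B \<in> \<F>" using assms(1) by blast
  have "B \<inter> \<Inter>\<F> \<noteq> {}"
  proof (rule compact_imp_fip)
    show "compact B" and "\<And>T. T \<in> \<F> \<Longrightarrow> closed T"
      using comp B by (auto intro: compact_imp_closed)
    fix \<G> assume \<G>: "finite \<G>" "\<G> \<subseteq> \<F>"
    have "\<Inter>(insert B \<G>) \<in> insert B \<G>"
    proof (rule finite_Inf_in)
      show "finite (insert B \<G>)" "insert B \<G> \<noteq> {}" using \<G> by auto
      show "S \<inter> T \<in> insert B \<G>" if "S \<in> insert B \<G>" "T \<in> insert B \<G>" for S T
      proof -
        have "S \<in> \<F>" "T \<in> \<F>" using that \<G> B by auto
        then have "S \<inter> T = S \<or> S \<inter> T = T" using chain by blast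
        then show ?thesis using that by metis
      qed
    qed
    moreover have "insert B \<G> \<subseteq> \<F>" using \<G> B by simp
    ultimately have "\<Inter>(insert B \<G>) \<in> \<F>" by (rule rev_subsetD)
    then show "B \<inter> \<Inter>\<G> \<noteq> {}" using ne unfolding Inter_insert by metis
  qed
  then show ?thesis by blast
qed

lemma compact_increasing_cover:
  fixes K :: "'a::t2_space set" and G :: "nat \<Rightarrow> 'a set"
  assumes K: "compact K" and op: "\<And>j. openin (top_of_set K) (G j)"
    and mono: "\<And>i j. i \<le> j \<Longrightarrow> G i \<subseteq> G j" and cover: "\<And>x. x \<in> K \<Longrightarrow> \<exists>j. x \<in> G j"
  shows "\<exists>j. K \<subseteq> G j"
proof (rule ccontr)
  assume no: "\<nexists>j. K \<subseteq> G j"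
  have "\<Inter>(range (\<lambda>j. K - G j)) \<noteq> {}"
  proof (rule Inter_chain_nonempty)
    show "compact S" if "S \<in> range (\<lambda>j. K - G j)" for S
    proof -
      have "closedin (top_of_set K) S"
        using that op by (auto intro!: closedin_diff)
      then show ?thesis using K closedin_compact by blast
    qed
    show "{} \<notin> range (\<lambda>j. K - G j)" using no by auto
    show "S \<subseteq> T \<or> T \<subseteq> S"
      if "S \<in> range (\<lambda>j. K - G j)" "T \<in> range (\<lambda>j. K - G j)" for S T
    proof -
      obtain i j where "S = K - G i" "T = K - G j" using \<open>S \<in> _\<close> \<open>T \<in> _\<close> by blast
      then show ?thesis using mono[of i j] mono[of j i] nat_le_linear[of i j] by blast
    qed
  qed simp
  then show False using cover by blast
qed

lemma Baire_closed_cover: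
  fixes K :: "'a::metric_space set" and A :: "nat \<Rightarrow> 'a set"
  assumes K: "compact K" and V: "openin (top_of_set K) V" "V \<noteq> {}"
    and cl: "\<And>N. closed (A N)" and cover: "\<And>x. x \<in> V \<Longrightarrow> \<exists>N. x \<in> A N"
  shows "\<exists>N U. openin (top_of_set K) U \<and> U \<noteq> {} \<and> U \<subseteq> A N"
proof (rule ccontr)
  assume no: "\<not> ?thesis"
  let ?T = "top_of_set K"
  have "?T interior_of \<Union>(range (\<lambda>N. K \<inter> A N)) = {}"
  proof (rule Baire_category_alt)
    have "compact_space ?T" using K by (simp add: compact_space_subtopology)
    moreover have "Hausdorff_space ?T"
      by (rule Hausdorff_space_subtopology) (rule Hausdorff_space_euclidean)
    ultimately show "completely_metrizable_space ?T \<or> locally_compact_space ?T \<and> regular_space ?T"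
      using compact_imp_locally_compact_space[of ?T] compact_Hausdorff_imp_regular_space[of ?T]
      by blast
    show "closedin ?T S \<and> ?T interior_of S = {}" if "S \<in> range (\<lambda>N. K \<inter> A N)" for S
    proof
      obtain N where N: "S = K \<inter> A N" using \<open>S \<in> _\<close> by blast
      then show "closedin ?T S" using closedin_closed_Int[OF cl[of N], of K] by blast
      have "?T interior_of S \<subseteq> A N"
        using interior_of_subset[of ?T S] N by blast
      then show "?T interior_of S = {}" using no openin_interior_of[of ?T S] by metis
    qed
  qed simp
  moreover have "V \<subseteq> ?T interior_of \<Union>(range (\<lambda>N. K \<inter> A N))"
  proof (rule interior_of_maximal)
    show "V \<subseteq> \<Union>(range (\<lambda>N. K \<inter> A N))" using cover openin_imp_subset[OF V(1)] by blast
  qed (rule V)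
  ultimately show False using V by blast
qed

lemma openin_Ball_finite:
  assumes "finite I" and "\<And>i. i \<in> I \<Longrightarrow> openin (top_of_set S) {x \<in> S. P i x}"
  shows "openin (top_of_set S) {x \<in> S. \<forall>i\<in>I. P i x}"
  using assms
proof (induction I rule: finite_induct)
  case (insert i I)
  have "{x \<in> S. \<forall>j\<in>insert i I. P j x} = {x \<in> S. P i x} \<inter> {x \<in> S. \<forall>j\<in>I. P j x}" by auto
  then show ?case using insert by (simp add: openin_Int)
qed simp

lemma openin_Bex:
  assumes "\<And>i. i \<in> I \<Longrightarrow> openin (top_of_set S) {x \<in> S. P i x}"
  shows "openin (top_of_set S) {x \<in> S. \<exists>i\<in>I. P i x}"
proof -
  have "{x \<in> S. \<exists>i\<in>I. P i x} = (\<Union>i\<in>I. {x \<in> S. P i x})" by auto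
  then show ?thesis using assms by auto
qed

lemma openin_disj:
  assumes "openin (top_of_set S) {x \<in> S. P x}" "openin (top_of_set S) {x \<in> S. Q x}"
  shows "openin (top_of_set S) {x \<in> S. P x \<or> Q x}"
proof -
  have "{x \<in> S. P x \<or> Q x} = {x \<in> S. P x} \<union> {x \<in> S. Q x}" by blast
  then show ?thesis using openin_Un[OF assms] by simp
qed

section \<open>Live paths and walls\<close>

text \<open>The cells of one orbit, reduced to what the combinatorial argument needs. The position
\<open>a\<close> in \<open>wall_ex\<close> is a wall: its dead neighbourhood has radius \<open>r\<close>, the speed of propagation, so
nothing can jump over it. The constants are shared by all orbits to which the locale is
applied, which is why bounds derived from them are uniform.\<close>

locale spacetime =
  fixes live :: "int \<Rightarrow> nat \<Rightarrow> bool"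
    and r L :: int and C :: nat and \<tau> :: "int \<Rightarrow> nat"
  assumes nonneg: "0 \<le> r" "0 \<le> L"
    and spread: "live n (Suc t) \<Longrightarrow> \<exists>k. \<bar>k\<bar> \<le> r \<and> live (n + k) t"
    and wall_ex: "live n t \<Longrightarrow>
           \<exists>a. \<bar>a - n\<bar> \<le> L \<and> (\<forall>s\<ge>t + C. \<forall>k. \<bar>k\<bar> \<le> r \<longrightarrow> \<not> live (a + k) s)"
    and quiet: "\<exists>s\<ge>t. s \<le> t + \<tau> D \<and> (\<forall>i. a \<le> i \<and> i \<le> a + D \<longrightarrow> \<not> live i s)"
begin

definition wall :: "int \<Rightarrow> nat \<Rightarrow> bool" where
  "wall a s \<longleftrightarrow> (\<forall>t\<ge>s. \<forall>k. \<bar>k\<bar> \<le> r \<longrightarrow> \<not> live (a + k) t)"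

definition live_path :: "(nat \<Rightarrow> int) \<Rightarrow> nat \<Rightarrow> bool" where
  "live_path p T \<longleftrightarrow> (\<forall>t\<le>T. live (p t) t) \<and> (\<forall>t<T. \<bar>p (Suc t) - p t\<bar> \<le> r)"

lemma live_path_ex:
  assumes "live n T"
  shows "\<exists>p. live_path p T"
proof -
  have "\<exists>p. live_path p T \<and> p T = n" using assms
  proof (induction T arbitrary: n)
    case 0
    then show ?case by (intro exI[of _ "\<lambda>_. n"]) (simp add: live_path_def)
  next
    case (Suc T)
    obtain k where k: "\<bar>k\<bar> \<le> r" "live (n + k) T" using spread[OF Suc.prems] by blast
    obtain p where p: "live_path p T" "p T = n + k" using Suc.IH[OF k(2)] by blast
    have "live_path (p(Suc T := n)) (Suc T) \<and> (p(Suc T := n)) (Suc T) = n"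
      using p Suc.prems k unfolding live_path_def by (auto simp: less_Suc_eq le_Suc_eq)
    then show ?case by blast
  qed
  then show ?thesis by blast
qed

lemma live_path_drift:
  assumes "live_path p T" "t + s \<le> T"
  shows "\<bar>p (t + s) - p t\<bar> \<le> r * int s"
  using assms(2)
proof (induction s)
  case (Suc s)
  have "\<bar>p (Suc (t + s)) - p (t + s)\<bar> \<le> r"
    using assms(1) Suc.prems unfolding live_path_def by auto
  then show ?case using Suc by (auto simp: algebra_simps)
qed simp

lemma wall_mono: "wall a s \<Longrightarrow> s \<le> t \<Longrightarrow> wall a t"
  unfolding wall_def by auto

lemma wall_dead: "wall a s \<Longrightarrow> s \<le> t \<Longrightarrow> \<not> live a t"
  unfolding wall_def using nonneg(1) by (metis abs_zero add.right_neutral)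

text \<open>Once the whole interval between two walls is dead at one moment it stays dead, because
new live cells could only enter through the walls; and \<open>quiet\<close> provides such a moment.\<close>

lemma trapped_dies:
  assumes wa: "wall a s" and wb: "wall b s" and D: "b - a \<le> D"
    and t: "s + \<tau> D \<le> t" and n: "a \<le> n" "n \<le> b"
  shows "\<not> live n t"
proof -
  obtain t0 where t0: "s \<le> t0" "t0 \<le> s + \<tau> D" "\<And>i. a \<le> i \<Longrightarrow> i \<le> a + D \<Longrightarrow> \<not> live i t0"
    using quiet[of s D a] by blast
  have "\<forall>i. a \<le> i \<and> i \<le> b \<longrightarrow> \<not> live i (t0 + u)" for u
  proof (induction u)
    case 0
    then show ?case using t0 D by auto
  next
    case (Suc u)
    show ?case
    proof (intro allI impI notI)
      fix i assume i: "a \<le> i \<and> i \<le> b" and l: "live i (t0 + Suc u)"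
      then obtain k where k: "\<bar>k\<bar> \<le> r" "live (i + k) (t0 + u)" using spread[of i "t0 + u"] by auto
      consider "i + k < a" | "b < i + k" | "a \<le> i + k" "i + k \<le> b" by linarith
      then show False
      proof cases
        case 1
        then have "\<bar>i + k - a\<bar> \<le> r" using k i by linarith
        then show False using wa k t0(1) unfolding wall_def
          by (metis add.commute diff_add_cancel trans_le_add1)
      next
        case 2
        then have "\<bar>i + k - b\<bar> \<le> r" using k i by linarith
        then show False using wb k t0(1) unfolding wall_def
          by (metis add.commute diff_add_cancel trans_le_add1)
      next
        case 3
        then show False using Suc k by blast
      qed
    qed
  qed
  from this[of "t - t0"] show ?thesis using t0 t n by auto
qed

lemma live_path_no_cross:
  assumes p: "live_path p T" and w: "wall a s" and "a < p s" "s \<le> t" "t \<le> T"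
  shows "a + r < p t"
  using \<open>s \<le> t\<close> \<open>t \<le> T\<close>
proof (induction t rule: dec_induct)
  case base
  have "\<not> \<bar>p s - a\<bar> \<le> r"
    using w p base unfolding wall_def live_path_def by (metis add.commute diff_add_cancel order_refl)
  then show ?case using \<open>a < p s\<close> by linarith
next
  case (step t)
  have "\<not> \<bar>p (Suc t) - a\<bar> \<le> r"
    using w p step unfolding wall_def live_path_def
    by (metis add.commute diff_add_cancel le_SucI)
  moreover have "\<bar>p (Suc t) - p t\<bar> \<le> r" using p step unfolding live_path_def by auto
  ultimately show ?case using step by auto
qed

lemma live_path_avoids_wall:
  assumes "live_path p T" "wall a s" "s \<le> t" "t \<le> T"
  shows "p t \<noteq> a"
  using assms wall_dead unfolding live_path_def by blast

text \<open>Left and right play symmetric roles; reflecting the cells transfers every result from one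
direction to the other.\<close>

lemma mirror: "spacetime (\<lambda>n. live (- n)) r L C \<tau>"
proof
  show "0 \<le> r" "0 \<le> L" by (rule nonneg)+
  show "\<exists>k. \<bar>k\<bar> \<le> r \<and> live (- (n + k)) t" if live: "live (- n) (Suc t)" for n t
  proof -
    obtain k where "\<bar>k\<bar> \<le> r" "live (- n + k) t" using spread[OF live] by blast
    then show ?thesis by (intro exI[of _ "- k"]) simp
  qed
  show "\<exists>a. \<bar>a - n\<bar> \<le> L \<and> (\<forall>s\<ge>t + C. \<forall>k. \<bar>k\<bar> \<le> r \<longrightarrow> \<not> live (- (a + k)) s)"
    if live: "live (- n) t" for n t
  proof -
    obtain a where a: "\<bar>a - - n\<bar> \<le> L" "\<And>s k. s \<ge> t + C \<Longrightarrow> \<bar>k\<bar> \<le> r \<Longrightarrow> \<not> live (a + k) s"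
      using wall_ex[OF live] by blast
    have "\<not> live (- (- a + k)) s" if "s \<ge> t + C" "\<bar>k\<bar> \<le> r" for s k
      using a(2)[of s "- k"] that by simp
    then show ?thesis using a(1) by (intro exI[of _ "- a"]) (auto simp: abs_minus_commute)
  qed
  show "\<exists>s\<ge>t. s \<le> t + \<tau> D \<and> (\<forall>i. a \<le> i \<and> i \<le> a + D \<longrightarrow> \<not> live (- i) s)" for t D a
  proof -
    obtain s where s: "s \<ge> t" "s \<le> t + \<tau> D"
      "\<And>i. - a - D \<le> i \<Longrightarrow> i \<le> - a - D + D \<Longrightarrow> \<not> live i s"
      using quiet[of t D "- a - D"] by blast
    then show ?thesis by (intro exI[of _ s]) auto
  qed
qed

lemma mirror_live_path:
  assumes "live_path p T"
  shows "spacetime.live_path (\<lambda>n. live (- n)) r (\<lambda>t. - p t) T"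
  using assms unfolding spacetime.live_path_def[OF mirror] live_path_def
  by (auto simp: abs_minus_commute)

lemma mirror_wall:
  assumes "wall a s"
  shows "spacetime.wall (\<lambda>n. live (- n)) r (- a) s"
  unfolding spacetime.wall_def[OF mirror]
proof (intro allI impI)
  fix t k assume "s \<le> t" "\<bar>k :: int\<bar> \<le> r"
  then have "\<not> live (a + - k) t" using assms unfolding wall_def by (metis abs_minus_cancel)
  then show "\<not> live (- (- a + k)) t" by simp
qed

lemma live_path_no_cross_left:
  assumes "live_path p T" "wall a s" "p s < a" "s \<le> t" "t \<le> T"
  shows "p t < a - r"
  using spacetime.live_path_no_cross[OF mirror mirror_live_path mirror_wall, of p T a s t] assms
  by simp

text \<open>After \<open>lag\<close> steps, everything between the walls left by two consecutive cells of a path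
has died. The cluster carried by a path has radius less than \<open>margin\<close>, because the path moves
by at most \<open>r * lag\<close> in that time. To see a cluster isolated up to distance \<open>E\<close>, the path must
have run for \<open>start E\<close> steps, so that it has left its origin far enough behind, and must
survive for another \<open>remaining E\<close> steps, so that it cannot be about to be trapped.\<close>

definition lag :: nat where "lag = C + \<tau> (2 * L + r) + 1"
definition margin :: int where "margin = r * int lag + L + 1"
definition start :: "int \<Rightarrow> nat" where "start E = 2 * C + lag + \<tau> (E + L)"
definition remaining :: "int \<Rightarrow> nat" where "remaining E = C + lag + \<tau> (E + 2 * L)"

text \<open>Starting from the first wall, the path stays to the right of every wall it leaves: if it
were to the right of one and to the left of the next, it would be trapped between the two.
Hence the walls chase the path, and the intervals between consecutive ones are dead up to a
bounded distance behind it. A live cell ahead of the path, beyond the margin, would put a wall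
in front of it and trap it.\<close>

lemma isolated_rightward:
  assumes p: "live_path p T" and a: "\<bar>a - p 0\<bar> \<le> L" "wall a C" "a < p C"
    and E: "0 \<le> E" and s: "start E \<le> s" "s + remaining E \<le> T"
    and n: "margin \<le> \<bar>n - p s\<bar>" "\<bar>n - p s\<bar> \<le> E"
  shows "\<not> live n s"
proof -
  have "\<forall>t. \<exists>b. t \<le> T \<longrightarrow> \<bar>b - p t\<bar> \<le> L \<and> wall b (t + C)"
    using p wall_ex unfolding live_path_def wall_def by (meson)
  then obtain w' where w': "\<And>t. t \<le> T \<Longrightarrow> \<bar>w' t - p t\<bar> \<le> L \<and> wall (w' t) (t + C)" by metis
  \<comment> \<open>The wall of the first cell must be the given one, whose side of the path is known.\<close>
  define w where "w = w'(0 := a)"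
  have near: "\<bar>w t - p t\<bar> \<le> L" and wall: "wall (w t) (t + C)" if "t \<le> T" for t
    using w' a that unfolding w_def by auto
  have step: "\<bar>w (Suc t) - w t\<bar> \<le> 2 * L + r" if "t < T" for t
  proof -
    have "\<bar>p (Suc t) - p t\<bar> \<le> r" using p that unfolding live_path_def by auto
    then show ?thesis using near[of t] near[of "Suc t"] that by linarith
  qed
  have right: "w t < p u" if "t + lag \<le> T" "t + C \<le> u" "u \<le> T" for t u
  proof -
    have "w t < p (t + C)" using \<open>t + lag \<le> T\<close>
    proof (induction t)
      case 0
      then show ?case using a by (simp add: w_def)
    next
      case (Suc t)
      let ?s = "Suc t + C" and ?D = "2 * L + r"
      have le: "t \<le> T" "Suc t \<le> T" "?s + \<tau> ?D \<le> T" using Suc.prems by (auto simp: lag_def)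
      have W: "wall (w t) ?s" "wall (w (Suc t)) ?s"
        using wall[OF le(1)] wall[OF le(2)] by (auto elim: wall_mono)
      have "w t < p (t + C)" using Suc by simp
      then have lo: "w t < p (?s + \<tau> ?D)"
        using live_path_no_cross[OF p wall[OF le(1)], of "?s + \<tau> ?D"] le nonneg by auto
      show ?case
      proof (rule ccontr)
        assume "\<not> ?thesis"
        then have "p ?s < w (Suc t)"
          using live_path_avoids_wall[OF p W(2), of ?s] le by auto
        then have hi: "p (?s + \<tau> ?D) < w (Suc t)"
          using live_path_no_cross_left[OF p W(2), of "?s + \<tau> ?D"] le nonneg by auto
        have "\<not> live (p (?s + \<tau> ?D)) (?s + \<tau> ?D)"
          using trapped_dies[OF W, of ?D "?s + \<tau> ?D" "p (?s + \<tau> ?D)"] lo hi step[of t] le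
          by auto
        then show False using p le unfolding live_path_def by blast
      qed
    qed
    moreover have "t \<le> T" using that by simp
    ultimately have "w t + r < p u"
      using live_path_no_cross[OF p wall] that by blast
    then show ?thesis using nonneg by linarith
  qed
  \<comment> \<open>The walls need not be ordered, but the intervals between neighbours
    cover everything from the first wall to any later one.\<close>
  have behind: "\<forall>i. w 0 \<le> i \<and> i \<le> w t \<longrightarrow> \<not> live i s" if "t + lag \<le> s" for t
    using that
  proof (induction t)
    case 0
    have "\<not> live (w 0) s"
      using wall_dead[OF wall[of 0], of s] 0 by (simp add: lag_def)
    then show ?case by (metis antisym)
  next
    case (Suc t)
    have le: "t < T" "t \<le> T" "Suc t \<le> T" using Suc.prems s by auto
    have W: "wall (w t) (Suc t + C)" "wall (w (Suc t)) (Suc t + C)"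
      using wall[OF le(2)] wall[OF le(3)] by (auto elim: wall_mono)
    have "\<not> live i s" if "w t \<le> i" "i \<le> w (Suc t)" for i
      using trapped_dies[OF W, of "2 * L + r" s i] that step[OF le(1)] Suc.prems
      by (auto simp: lag_def)
    then show ?case using Suc by (metis Suc_leD add_Suc linear)
  qed
  have far: "w 0 + E \<le> p s"
  proof -
    obtain t where t: "C \<le> t" "t \<le> C + \<tau> (E + L)"
      "\<And>i. w 0 \<le> i \<Longrightarrow> i \<le> w 0 + (E + L) \<Longrightarrow> \<not> live i t"
      using quiet[of C "E + L" "w 0"] by blast
    have le: "t + C \<le> s" "t + lag \<le> T" "s \<le> T" "t \<le> T" "lag \<le> T"
      using t s by (auto simp: start_def)
    have "w 0 < p t" using right[of 0 t] le t by simp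
    moreover have "live (p t) t" using p le unfolding live_path_def by blast
    ultimately have "w 0 + (E + L) < p t" using t(3)[of "p t"] by linarith
    then show ?thesis using right[of t s] le near[of t] by auto
  qed
  consider "n \<le> p s" | "p s \<le> n" by linarith
  then show ?thesis
  proof cases
    case 1
    have le: "lag \<le> s" "s \<le> T" using s by (auto simp: start_def)
    let ?t = "s - lag"
    have "\<bar>p (?t + lag) - p ?t\<bar> \<le> r * int lag"
      using live_path_drift[OF p, of ?t lag] le by simp
    moreover have "?t + lag = s" using le by simp
    moreover have "\<bar>w ?t - p ?t\<bar> \<le> L" using near[of ?t] le by simp
    ultimately have "n \<le> w ?t" using n(1) 1 by (auto simp: margin_def)
    moreover have "w 0 \<le> n" using far n 1 by linarith
    ultimately show ?thesis using behind[of ?t] le by simp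
  next
    case 2
    show ?thesis
    proof
      assume "live n s"
      then obtain b where b: "\<bar>b - n\<bar> \<le> L" "wall b (s + C)"
        using wall_ex unfolding wall_def by blast
      let ?u = "s + C + \<tau> (E + 2 * L)"
      have le: "s \<le> T" "s + C \<le> T" "s + lag \<le> T" "?u \<le> T" using s by (auto simp: remaining_def)
      have "\<bar>p (s + C) - p s\<bar> \<le> r * int C" by (rule live_path_drift[OF p le(2)])
      moreover have "r * int C \<le> r * int lag"
        using nonneg by (intro mult_left_mono) (auto simp: lag_def)
      ultimately have "p (s + C) < b" using b n 2 by (auto simp: margin_def)
      then have hi: "p ?u < b" using live_path_no_cross_left[OF p b(2), of ?u] le nonneg by auto
      have lo: "w s < p ?u" using right[of s ?u] le by auto
      have "b - w s \<le> E + 2 * L" using b n 2 near[OF le(1)] by linarith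
      then have "\<not> live (p ?u) ?u"
        using trapped_dies[OF wall[OF le(1)] b(2), of "E + 2 * L" ?u "p ?u"] lo hi by auto
      then show False using p le unfolding live_path_def by blast
    qed
  qed
qed

lemma isolated:
  assumes p: "live_path p T"
    and E: "0 \<le> E" and s: "start E \<le> s" "s + remaining E \<le> T"
    and n: "margin \<le> \<bar>n - p s\<bar>" "\<bar>n - p s\<bar> \<le> E"
  shows "\<not> live n s"
proof -
  have le: "C \<le> T" using s by (auto simp: start_def)
  obtain a where a: "\<bar>a - p 0\<bar> \<le> L" "wall a C"
    using wall_ex[of "p 0" 0] p unfolding wall_def live_path_def by auto
  have "p C \<noteq> a" by (rule live_path_avoids_wall[OF p a(2) order_refl le])
  then consider "a < p C" | "p C < a" by linarith
  then show ?thesis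
  proof cases
    case 1
    then show ?thesis using isolated_rightward[OF p a _ E s n] by simp
  next
    case 2
    interpret m: spacetime "\<lambda>n. live (- n)" r L C \<tau> by (rule mirror)
    have "\<not> live (- (- n)) s"
    proof (rule m.isolated_rightward[OF mirror_live_path[OF p] _ mirror_wall[OF a(2)] _ E])
      show "m.start E \<le> s" "s + m.remaining E \<le> T"
        using s unfolding start_def m.start_def remaining_def m.remaining_def lag_def m.lag_def
        by auto
      show "m.margin \<le> \<bar>- n - - p s\<bar>" "\<bar>- n - - p s\<bar> \<le> E"
        using n unfolding margin_def m.margin_def lag_def m.lag_def by auto
    qed (use a 2 in auto)
    then show ?thesis by simp
  qed
qed

end

section \<open>Asymptotically nilpotent endomorphisms of expansive systems\<close>

text \<open>The constant \<open>\<Delta>\<close> is fixed here, so that half of it can serve as the threshold of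
liveness: two points both below the threshold at a cell are then within \<open>\<Delta>\<close> of each other
there.\<close>

locale nil_endo =
  fixes X :: "'a::metric_space set" and act :: "int \<Rightarrow> 'a \<Rightarrow> 'a" and o\<^sub>X :: 'a
    and f :: "'a \<Rightarrow> 'a" and \<Delta> :: real
  assumes system: "pointed_Z_system X act o\<^sub>X"
    and \<Delta>_pos: "0 < \<Delta>"
    and separate: "\<And>x y. x \<in> X \<Longrightarrow> y \<in> X \<Longrightarrow> (\<And>n. dist (act n x) (act n y) \<le> \<Delta>) \<Longrightarrow> x = y"
    and endo: "endomorphism X act o\<^sub>X f"
    and nil: "asymptotically_nilpotent X o\<^sub>X f"
begin

definition height :: "'a \<Rightarrow> int \<Rightarrow> nat \<Rightarrow> real" where
  "height x n t = dist (act n ((f ^^ t) x)) o\<^sub>X"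

definition \<delta> :: real where "\<delta> = \<Delta> / 2"

lemma \<delta>_pos: "0 < \<delta>" and \<delta>_less: "\<delta> < \<Delta>"
  using \<Delta>_pos by (auto simp: \<delta>_def)

lemma compact_X: "compact X" and base_in: "o\<^sub>X \<in> X" and act_base [simp]: "act n o\<^sub>X = o\<^sub>X"
  and act_in: "x \<in> X \<Longrightarrow> act n x \<in> X" and act_0: "x \<in> X \<Longrightarrow> act 0 x = x"
  and act_act: "x \<in> X \<Longrightarrow> act m (act n x) = act (m + n) x"
  and act_cont: "continuous_on X (act n)"
  using system unfolding pointed_Z_system_def by auto

lemma f_in: "x \<in> X \<Longrightarrow> f x \<in> X" and f_cont: "continuous_on X f" and f_base: "f o\<^sub>X = o\<^sub>X"
  and f_act: "x \<in> X \<Longrightarrow> f (act n x) = act n (f x)"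
  using endo unfolding endomorphism_def by auto

lemma iter_in: "x \<in> X \<Longrightarrow> (f ^^ t) x \<in> X"
  by (induction t) (auto intro: f_in)

lemma iter_base [simp]: "(f ^^ t) o\<^sub>X = o\<^sub>X"
  by (induction t) (auto simp: f_base)

lemma iter_act: "x \<in> X \<Longrightarrow> (f ^^ t) (act n x) = act n ((f ^^ t) x)"
  by (induction t) (auto simp: f_act iter_in)

lemma iter_cont: "continuous_on X (f ^^ t)"
proof (induction t)
  case (Suc t)
  have "continuous_on X (f \<circ> (f ^^ t))"
    using Suc continuous_on_subset[OF f_cont, of "(f ^^ t) ` X"] iter_in
    by (intro continuous_on_compose) auto
  then show ?case by simp
qed simp

lemma act_iter_cont: "continuous_on X (\<lambda>x. act n ((f ^^ t) x))"
proof -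
  have "continuous_on X (act n \<circ> (f ^^ t))"
    using iter_cont continuous_on_subset[OF act_cont, of "(f ^^ t) ` X"] iter_in
    by (intro continuous_on_compose) auto
  then show ?thesis by (simp add: comp_def)
qed

lemma height_cont: "continuous_on X (\<lambda>x. height x n t)"
  unfolding height_def using act_iter_cont by (intro continuous_intros)

lemma height_shift:
  assumes "x \<in> X"
  shows "height (act m ((f ^^ s) x)) n t = height x (n + m) (t + s)"
  using assms by (simp add: height_def iter_act iter_in act_act funpow_add)

lemma height_0: "x \<in> X \<Longrightarrow> height x 0 t = dist ((f ^^ t) x) o\<^sub>X"
  by (simp add: height_def act_0 iter_in)

lemma height_tendsto:
  assumes "x \<in> X"
  shows "(\<lambda>t. height x n t) \<longlonglongrightarrow> 0"
proof -
  have "(\<lambda>t. (f ^^ t) (act n x)) \<longlonglongrightarrow> o\<^sub>X"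
    using nil act_in[OF assms] unfolding asymptotically_nilpotent_def by blast
  then show ?thesis
    unfolding height_def iter_act[OF assms] by (subst (asm) tendsto_dist_iff)
qed

lemma height_eventually:
  assumes "x \<in> X" "finite I" "0 < c"
  shows "\<exists>T. \<forall>t\<ge>T. \<forall>n\<in>I. height x n t < c"
proof -
  have "eventually (\<lambda>t. \<forall>n\<in>I. height x n t < c) sequentially"
    using assms height_tendsto by (intro eventually_ball_finite) (auto intro: order_tendstoD)
  then show ?thesis by (simp add: eventually_sequentially)
qed

lemma openin_height_less:
  assumes "Y \<subseteq> X"
  shows "openin (top_of_set Y) {y \<in> Y. height y n t < c}"
proof -
  have "{y \<in> Y. height y n t < c} = Y \<inter> (\<lambda>y. height y n t) -` {..<c}" by auto
  then show ?thesis
    using continuous_openin_preimage_gen[OF continuous_on_subset[OF height_cont assms]] by simp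
qed

lemma openin_height_greater:
  assumes "Y \<subseteq> X"
  shows "openin (top_of_set Y) {y \<in> Y. c < height y n t}"
proof -
  have "{y \<in> Y. c < height y n t} = Y \<inter> (\<lambda>y. height y n t) -` {c<..}" by auto
  then show ?thesis
    using continuous_openin_preimage_gen[OF continuous_on_subset[OF height_cont assms]] by simp
qed

lemma base_eqI:
  assumes "x \<in> X" "\<And>n. height x n t \<le> \<Delta>"
  shows "(f ^^ t) x = o\<^sub>X"
  using separate[OF iter_in[OF assms(1), of t] base_in] assms by (simp add: height_def)

text \<open>Smallness on a large window forces closeness to the fixed point: a point that is small
everywhere is the fixed point by expansivity, and compactness makes the window uniform.\<close>

lemma near_base:
  assumes W: "openin (top_of_set X) W" "o\<^sub>X \<in> W"
  shows "\<exists>j\<ge>0. \<forall>x\<in>X. (\<forall>k. \<bar>k\<bar> \<le> j \<longrightarrow> height x k 0 \<le> \<delta>) \<longrightarrow> x \<in> W"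
proof -
  define G where "G j = {x \<in> X. x \<in> W \<or> (\<exists>k\<in>{- int j..int j}. \<delta> < height x k 0)}" for j
  have "\<exists>j. X \<subseteq> G j"
  proof (rule compact_increasing_cover[OF compact_X])
    have "{x \<in> X. x \<in> W} = W" using openin_imp_subset[OF W(1)] by blast
    then show "openin (top_of_set X) (G j)" for j
      unfolding G_def using W(1) by (intro openin_disj openin_Bex openin_height_greater) auto
    show "\<exists>j. x \<in> G j" if "x \<in> X" for x
    proof (cases "\<exists>k. \<delta> < height x k 0")
      case True
      then obtain k where "\<delta> < height x k 0" by blast
      then have "x \<in> G (nat \<bar>k\<bar>)" using \<open>x \<in> X\<close> unfolding G_def by force
      then show ?thesis by blast
    next
      case False
      then have "height x n 0 \<le> \<Delta>" for n
        using \<delta>_less by (meson not_less order.trans less_imp_le)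
      then have "x = o\<^sub>X" using base_eqI[OF that, of 0] by simp
      then show ?thesis using W base_in unfolding G_def by blast
    qed
  qed (auto simp: G_def; force)
  then obtain j where "X \<subseteq> G j" by blast
  have "x \<in> W" if "x \<in> X" "\<forall>k. \<bar>k\<bar> \<le> int j \<longrightarrow> height x k 0 \<le> \<delta>" for x
  proof -
    have "x \<in> G j" using \<open>X \<subseteq> G j\<close> that(1) by blast
    then consider "x \<in> W" | k where "- int j \<le> k" "k \<le> int j" "\<delta> < height x k 0"
      unfolding G_def by auto
    then show ?thesis
    proof cases
      case (2 k)
      then have "\<bar>k\<bar> \<le> int j" by linarith
      then show ?thesis using that(2) 2(3) by (meson not_le)
    qed
  qed
  then show ?thesis by (intro exI[of _ "int j"]) simp
qed

lemma radius_ex: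
  "\<exists>r\<ge>0. \<forall>x\<in>X. \<forall>n t. \<delta> \<le> height x n (Suc t) \<longrightarrow> (\<exists>k. \<bar>k\<bar> \<le> r \<and> \<delta> \<le> height x (n + k) t)"
proof -
  have "o\<^sub>X \<in> {x \<in> X. height x 0 1 < \<delta>}" using base_in \<delta>_pos by (simp add: height_0 f_base)
  then obtain r where r: "0 \<le> r" "\<And>x. x \<in> X \<Longrightarrow> (\<And>k. \<bar>k\<bar> \<le> r \<Longrightarrow> height x k 0 \<le> \<delta>) \<Longrightarrow> height x 0 1 < \<delta>"
    using near_base[OF openin_height_less[OF order_refl, of 0 1 \<delta>]] by blast
  have "\<exists>k. \<bar>k\<bar> \<le> r \<and> \<delta> \<le> height x (n + k) t" if x: "x \<in> X" "\<delta> \<le> height x n (Suc t)" for x n t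
  proof (rule ccontr)
    assume no: "\<not> ?thesis"
    have "height (act n ((f ^^ t) x)) k 0 \<le> \<delta>" if "\<bar>k\<bar> \<le> r" for k
      using no that height_shift[OF x(1), of n t k 0]
      by (metis add.commute add_0 less_imp_le not_le)
    then have "height (act n ((f ^^ t) x)) 0 1 < \<delta>" using r(2) act_in iter_in x(1) by blast
    then show False using x height_shift[OF x(1), of n t 0 1] by simp
  qed
  then show ?thesis using r(1) by blast
qed

text \<open>Each orbit empties the window eventually, and emptiness at a given time is an open
condition.\<close>

lemma quiet_time:
  "\<exists>T. \<forall>x\<in>X. \<exists>t\<le>T. \<forall>i\<in>{0..D :: int}. height x i t < \<delta>"
proof -
  define G where "G T = {x \<in> X. \<exists>t\<in>{..T :: nat}. \<forall>i\<in>{0..D}. height x i t < \<delta>}" for T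
  have "\<exists>T. X \<subseteq> G T"
  proof (rule compact_increasing_cover[OF compact_X])
    show "openin (top_of_set X) (G T)" for T
      unfolding G_def by (intro openin_Bex openin_Ball_finite openin_height_less) auto
    show "\<exists>T. x \<in> G T" if x: "x \<in> X" for x
    proof -
      obtain T where "\<forall>t\<ge>T. \<forall>n\<in>{0..D}. height x n t < \<delta>"
        using height_eventually[OF x _ \<delta>_pos, of "{0..D}"] by auto
      then have "x \<in> G T" using x unfolding G_def by blast
      then show ?thesis ..
    qed
  qed (force simp: G_def)
  then show ?thesis unfolding G_def by blast
qed

lemma quiet_time_ex:
  "\<exists>\<tau>. \<forall>x\<in>X. \<forall>D a t. \<exists>s\<ge>t. s \<le> t + \<tau> D \<and> (\<forall>i. a \<le> i \<and> i \<le> a + D \<longrightarrow> height x i s < \<delta>)"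
proof -
  obtain \<tau> where \<tau>: "\<And>D x. x \<in> X \<Longrightarrow> \<exists>t\<le>\<tau> D. \<forall>i\<in>{0..D :: int}. height x i t < \<delta>"
    using quiet_time by metis
  have "\<exists>s\<ge>t. s \<le> t + \<tau> D \<and> (\<forall>i. a \<le> i \<and> i \<le> a + D \<longrightarrow> height x i s < \<delta>)"
    if x: "x \<in> X" for x D a t
  proof -
    obtain s where s: "s \<le> \<tau> D" "\<forall>i\<in>{0..D}. height (act a ((f ^^ t) x)) i s < \<delta>"
      using \<tau>[OF act_in[OF iter_in[OF x]]] by blast
    have "height x i (s + t) < \<delta>" if "a \<le> i" "i \<le> a + D" for i
      using s(2)[rule_format, of "i - a"] that height_shift[OF x, of a t "i - a" s] by simp
    then show ?thesis using s(1) by (intro exI[of _ "s + t"]) auto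
  qed
  then show ?thesis by blast
qed

section \<open>Walls in a minimal subsystem\<close>

definition stable :: "'a set \<Rightarrow> bool" where
  "stable Y \<longleftrightarrow> compact Y \<and> Y \<subseteq> X \<and> (\<forall>y\<in>Y. f y \<in> Y \<and> (\<forall>n. act n y \<in> Y))"

definition undying :: "'a set \<Rightarrow> bool" where
  "undying Y \<longleftrightarrow> (\<forall>M. \<exists>y\<in>Y. (f ^^ M) y \<noteq> o\<^sub>X)"

lemma stable_iter:
  assumes "stable Y" "y \<in> Y"
  shows "(f ^^ t) y \<in> Y"
  by (induction t) (use assms in \<open>auto simp: stable_def\<close>)

text \<open>Being nonzero is not a closed condition, but after a translation it becomes visible at
cell 0 with size at least \<open>\<Delta>\<close>; in this form it passes to intersections of chains.\<close>

lemma undying_height: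
  assumes "stable Y" "undying Y"
  shows "\<exists>y\<in>Y. \<Delta> < height y 0 M"
proof -
  have YX: "Y \<subseteq> X" using assms unfolding stable_def by blast
  obtain y where y: "y \<in> Y" "(f ^^ M) y \<noteq> o\<^sub>X" using assms unfolding undying_def by blast
  then obtain n where "\<Delta> < height y n M" using base_eqI[of y M] YX by (meson not_le subsetD)
  then have "\<Delta> < height (act n y) 0 M"
    using height_shift[of y n 0 0 M] y YX by auto
  then show ?thesis using y assms unfolding stable_def by blast
qed

text \<open>Zorn's lemma provides maximal sets, so it is applied to complements.\<close>

lemma minimal_undying:
  assumes "undying X"
  shows "\<exists>Y. stable Y \<and> undying Y \<and> (\<forall>Z. stable Z \<and> undying Z \<and> Z \<subseteq> Y \<longrightarrow> Z = Y)"
proof -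
  let ?A = "uminus ` {Y. stable Y \<and> undying Y}"
  have "\<exists>M\<in>?A. \<forall>Z\<in>?A. M \<subseteq> Z \<longrightarrow> Z = M"
  proof (rule subset_Zorn_nonempty)
    have "stable X" using compact_X f_in act_in by (auto simp: stable_def)
    then show "?A \<noteq> {}" using assms by auto
    fix \<C> assume ne: "\<C> \<noteq> {}" and ch: "subset.chain ?A \<C>"
    define \<D> where "\<D> = uminus ` \<C>"
    have \<D>: "stable S \<and> undying S" if "S \<in> \<D>" for S
      using ch that unfolding \<D>_def subset.chain_def by auto
    have chain: "S \<subseteq> T \<or> T \<subseteq> S" if ST: "S \<in> \<D>" "T \<in> \<D>" for S T
    proof -
      obtain S' where S': "S = - S'" "S' \<in> \<C>"
        using ST(1) unfolding \<D>_def by (rule imageE)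
      obtain T' where T': "T = - T'" "T' \<in> \<C>"
        using ST(2) unfolding \<D>_def by (rule imageE)
      have "S' \<subseteq> T' \<or> T' \<subseteq> S'"
        using subset.chain_total[OF ch S'(2) T'(2)] by (auto simp: psubset_eq)
      then show ?thesis unfolding S'(1) T'(1) Compl_subset_Compl_iff by (rule disj_commute[THEN iffD1])
    qed
    have neD: "\<D> \<noteq> {}" using ne unfolding \<D>_def by simp
    have st: "stable (\<Inter>\<D>)"
    proof -
      obtain S where S: "S \<in> \<D>" using neD by blast
      have "compact (\<Inter>\<D>)"
      proof -
        have "closed T" if "T \<in> \<D>" for T
          using \<D>[OF that] unfolding stable_def by (blast intro: compact_imp_closed)
        then have "closed (\<Inter>\<D>)" by (simp add: closed_Inter)
        moreover have "compact S" using \<D>[OF S] unfolding stable_def by blast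
        ultimately have "compact (S \<inter> \<Inter>\<D>)" by (simp add: compact_Int_closed)
        moreover have "S \<inter> \<Inter>\<D> = \<Inter>\<D>" using S by blast
        ultimately show ?thesis by simp
      qed
      moreover have "\<Inter>\<D> \<subseteq> X" using \<D>[OF S] S unfolding stable_def by blast
      moreover have "f y \<in> \<Inter>\<D>" "act n y \<in> \<Inter>\<D>" if "y \<in> \<Inter>\<D>" for y n
        using \<D> that unfolding stable_def by (simp_all add: Inter_iff)
      ultimately show ?thesis unfolding stable_def by simp
    qed
    have "undying (\<Inter>\<D>)"
      unfolding undying_def
    proof
      fix M
      let ?\<E> = "(\<lambda>S. {y \<in> S. \<Delta> \<le> height y 0 M}) ` \<D>"
      have "\<Inter>?\<E> \<noteq> {}"
      proof (rule Inter_chain_nonempty)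
        show "?\<E> \<noteq> {}" using neD by simp
        show "compact S" if S: "S \<in> ?\<E>" for S
        proof -
          obtain T where T: "S = {y \<in> T. \<Delta> \<le> height y 0 M}" "T \<in> \<D>"
            using S by (rule imageE)
          have "T \<subseteq> X" "compact T" using \<D>[OF T(2)] unfolding stable_def by auto
          moreover have "S = T - {y \<in> T. height y 0 M < \<Delta>}" using T(1) by auto
          ultimately have "closedin (top_of_set T) S"
            using openin_height_less[of T 0 M \<Delta>] by (simp add: closedin_diff)
          then show ?thesis using \<open>compact T\<close> closedin_compact by blast
        qed
        show "{} \<notin> ?\<E>"
        proof
          assume "{} \<in> ?\<E>"
          then obtain S where S: "{} = {y \<in> S. \<Delta> \<le> height y 0 M}" "S \<in> \<D>" by (rule imageE)
          then show False using undying_height[of S M] \<D>[OF S(2)] by fastforce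
        qed
        show "S \<subseteq> T \<or> T \<subseteq> S" if ST: "S \<in> ?\<E>" "T \<in> ?\<E>" for S T
        proof -
          obtain S' where S': "S = {y \<in> S'. \<Delta> \<le> height y 0 M}" "S' \<in> \<D>"
            using ST(1) by (rule imageE)
          obtain T' where T': "T = {y \<in> T'. \<Delta> \<le> height y 0 M}" "T' \<in> \<D>"
            using ST(2) by (rule imageE)
          show ?thesis using chain[OF S'(2) T'(2)] unfolding S'(1) T'(1) by blast
        qed
      qed
      then obtain y where y: "\<And>S. S \<in> \<D> \<Longrightarrow> y \<in> S \<and> \<Delta> \<le> height y 0 M" by auto
      then have yD: "y \<in> \<Inter>\<D>" and "\<Delta> \<le> height y 0 M" using neD by auto
      moreover have "height y 0 M = 0" if "(f ^^ M) y = o\<^sub>X" by (simp add: height_def that)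
      ultimately have "(f ^^ M) y \<noteq> o\<^sub>X" using \<Delta>_pos by linarith
      then show "\<exists>y\<in>\<Inter>\<D>. (f ^^ M) y \<noteq> o\<^sub>X" using yD by (rule bexI)
    qed
    with st have "- \<Inter>\<D> \<in> ?A" by (intro imageI) simp
    moreover have "\<Union>\<C> = - \<Inter>\<D>" unfolding \<D>_def by simp
    ultimately show "\<Union>\<C> \<in> ?A" by simp
  qed
  then obtain Y where Y: "stable Y" "undying Y"
    and max: "\<forall>Z\<in>?A. - Y \<subseteq> Z \<longrightarrow> Z = - Y" by blast
  have "Z = Y" if "stable Z" "undying Z" "Z \<subseteq> Y" for Z
    using max[rule_format, of "- Z"] that by auto
  then show ?thesis using Y by blast
qed

text \<open>Minimality of \<open>Y\<close> does two things. It gives \<open>f Y = Y\<close>, so every point of \<open>Y\<close> has an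
\<open>M\<close>-fold preimage in \<open>Y\<close>; and it makes \<open>f\<close> nilpotent on the set \<open>D\<close> of points whose orbit
avoids the open set \<open>U\<close> given by Baire's theorem. A live cell in \<open>f\<^sup>M x\<close> shows that \<open>x\<close> is away
from \<open>D\<close> near that cell, so the orbit of \<open>x\<close> visits \<open>U\<close> nearby and soon, and each visit to \<open>U\<close>
creates a wall.\<close>

lemma walls_ex:
  assumes "undying X"
  shows "\<exists>Y L C. stable Y \<and> undying Y \<and> 0 \<le> L \<and>
    (\<forall>z\<in>Y. \<forall>n t. \<delta> \<le> height z n t \<longrightarrow>
       (\<exists>a. \<bar>a - n\<bar> \<le> L \<and> (\<forall>s\<ge>t + C. \<forall>k. \<bar>k\<bar> \<le> r \<longrightarrow> height z (a + k) s < \<delta>)))"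
proof -
  obtain Y where Y: "stable Y" "undying Y"
    and min: "\<And>Z. stable Z \<Longrightarrow> undying Z \<Longrightarrow> Z \<subseteq> Y \<Longrightarrow> Z = Y"
    using minimal_undying[OF assms] by blast
  have YX: "Y \<subseteq> X" and compY: "compact Y" and fY: "\<And>y. y \<in> Y \<Longrightarrow> f y \<in> Y"
    and actY: "\<And>n y. y \<in> Y \<Longrightarrow> act n y \<in> Y"
    using Y(1) unfolding stable_def by auto
  have inX: "y \<in> X" if "y \<in> Y" for y using YX that by blast
  have iterY: "\<And>t y. y \<in> Y \<Longrightarrow> (f ^^ t) y \<in> Y" using stable_iter[OF Y(1)] .
  have "f ` Y = Y"
  proof (rule min)
    have "compact (f ` Y)"
      using continuous_on_subset[OF f_cont YX] compY by (rule compact_continuous_image)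
    moreover have "act n (f y) \<in> f ` Y" if "y \<in> Y" for n y
      using f_act[OF inX[OF that], of n] actY[OF that] by (metis imageI)
    ultimately show "stable (f ` Y)" using fY YX unfolding stable_def by auto
    show "undying (f ` Y)"
      unfolding undying_def
    proof
      fix M
      obtain y where "y \<in> Y" "(f ^^ Suc M) y \<noteq> o\<^sub>X" using Y(2) unfolding undying_def by blast
      then show "\<exists>y\<in>f ` Y. (f ^^ M) y \<noteq> o\<^sub>X" by (auto simp: funpow_swap1)
    qed
    show "f ` Y \<subseteq> Y" using fY by blast
  qed
  then have onto: "(f ^^ M) ` Y = Y" for M
  proof (induction M)
    case (Suc M)
    have "(f ^^ Suc M) ` Y = f ` ((f ^^ M) ` Y)" by (simp only: funpow.simps image_comp)
    then show ?case using Suc \<open>f ` Y = Y\<close> by simp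
  qed simp
  \<comment> \<open>The threshold \<open>\<delta> / 2\<close> lies strictly below \<open>\<delta>\<close>: the condition is closed,
    as Baire's theorem needs, and still implies that the cells are dead.\<close>
  define A where "A N = Y - {y \<in> Y. \<exists>p\<in>{(m, k). N \<le> m \<and> \<bar>k\<bar> \<le> r}.
      \<delta> / 2 < height y (snd p) (fst p)}" for N
  have A_iff: "y \<in> A N \<longleftrightarrow> y \<in> Y \<and> (\<forall>m\<ge>N. \<forall>k. \<bar>k\<bar> \<le> r \<longrightarrow> height y k m \<le> \<delta> / 2)" for y N
    unfolding A_def by (auto simp: not_less)
  have "\<exists>N U. openin (top_of_set Y) U \<and> U \<noteq> {} \<and> U \<subseteq> A N"
  proof (rule Baire_closed_cover[OF compY])
    show "openin (top_of_set Y) Y" by simp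
    show "Y \<noteq> {}" using Y(2) unfolding undying_def by blast
    show "closed (A N)" for N
    proof -
      have "openin (top_of_set Y) {y \<in> Y. \<exists>p\<in>{(m, k). N \<le> m \<and> \<bar>k\<bar> \<le> r}.
      \<delta> / 2 < height y (snd p) (fst p)}"
        by (intro openin_Bex openin_height_greater YX)
      then have "closedin (top_of_set Y) (A N)" unfolding A_def by (simp add: closedin_diff)
      then show ?thesis using compY closedin_compact compact_imp_closed by blast
    qed
    show "\<exists>N. y \<in> A N" if y: "y \<in> Y" for y
    proof -
      obtain T where T: "\<forall>t\<ge>T. \<forall>n\<in>{-r..r}. height y n t < \<delta> / 2"
        using height_eventually[OF inX[OF y], of "{-r..r}" "\<delta> / 2"] \<delta>_pos by auto
      have "y \<in> A T" unfolding A_iff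
      proof (intro conjI y allI impI)
        fix m k assume "T \<le> m" "\<bar>k\<bar> \<le> r"
        then have "k \<in> {-r..r}" by auto
        then show "height y k m \<le> \<delta> / 2" using T \<open>T \<le> m\<close> by (auto intro: less_imp_le)
      qed
      then show ?thesis ..
    qed
  qed
  then obtain N U where U: "openin (top_of_set Y) U" "U \<noteq> {}" "U \<subseteq> A N" by blast
  have UY: "U \<subseteq> Y" using openin_imp_subset[OF U(1)] .
  have openU: "openin (top_of_set Y) {y \<in> Y. act n ((f ^^ t) y) \<in> U}" for n t
  proof -
    have "openin (top_of_set Y) (Y \<inter> (\<lambda>y. act n ((f ^^ t) y)) -` U)"
      using continuous_on_subset[OF act_iter_cont YX] actY iterY U(1)
      by (intro continuous_openin_preimage) auto
    moreover have "Y \<inter> (\<lambda>y. act n ((f ^^ t) y)) -` U = {y \<in> Y. act n ((f ^^ t) y) \<in> U}" by auto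
    ultimately show ?thesis by simp
  qed
  define D where "D = Y - {y \<in> Y. \<exists>(n, t)\<in>UNIV. act n ((f ^^ t) y) \<in> U}"
  have D_iff: "y \<in> D \<longleftrightarrow> y \<in> Y \<and> (\<forall>n t. act n ((f ^^ t) y) \<notin> U)" for y
    unfolding D_def by auto
  have "stable D"
    unfolding stable_def
  proof (intro conjI ballI allI)
    have "openin (top_of_set Y) {y \<in> Y. \<exists>(n, t)\<in>UNIV. act n ((f ^^ t) y) \<in> U}"
      using openU by (intro openin_Bex) auto
    then have "closedin (top_of_set Y) D" unfolding D_def by (simp add: closedin_diff)
    then show "compact D" using compY closedin_compact by blast
    show "D \<subseteq> X" using YX unfolding D_def by blast
    show "f y \<in> D" if "y \<in> D" for y
      using that fY unfolding D_iff by (metis comp_apply funpow_Suc_right)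
    show "act m y \<in> D" if y: "y \<in> D" for m y
    proof -
      have "act n ((f ^^ t) (act m y)) = act (n + m) ((f ^^ t) y)" for n t
        using y inX unfolding D_iff by (simp add: iter_act act_act iter_in)
      then show ?thesis using y actY unfolding D_iff by simp
    qed
  qed
  moreover have "D \<noteq> Y"
  proof -
    obtain u where "u \<in> U" using U(2) by blast
    then have "act 0 ((f ^^ 0) u) \<in> U" "u \<in> Y" using UY inX by (auto simp: act_0)
    then show ?thesis using D_iff by blast
  qed
  ultimately have "\<not> undying D" using min[of D] D_iff by blast
  then obtain M where M: "\<And>y. y \<in> D \<Longrightarrow> (f ^^ M) y = o\<^sub>X" unfolding undying_def by blast
  define G where "G j = {y \<in> Y. height y 0 M < \<delta> \<or>
      (\<exists>(n, t)\<in>{- int j..int j} \<times> {..j}. act n ((f ^^ t) y) \<in> U)}" for j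
  have "\<exists>j. Y \<subseteq> G j"
  proof (rule compact_increasing_cover[OF compY])
    show "openin (top_of_set Y) (G j)" for j
      unfolding G_def using openU
      by (intro openin_disj openin_height_less[OF YX] openin_Bex) auto
    show "G i \<subseteq> G j" if "i \<le> j" for i j using that unfolding G_def by force
    show "\<exists>j. y \<in> G j" if y: "y \<in> Y" for y
    proof (cases "y \<in> D")
      case True
      then have "height y 0 M < \<delta>" using M \<delta>_pos by (simp add: height_def)
      then show ?thesis using y unfolding G_def by blast
    next
      case False
      then obtain n t where nt: "act n ((f ^^ t) y) \<in> U" using y D_iff by blast
      have "(n, t) \<in> {- int (nat \<bar>n\<bar> + t)..int (nat \<bar>n\<bar> + t)} \<times> {..nat \<bar>n\<bar> + t}" by auto
      then have "y \<in> G (nat \<bar>n\<bar> + t)" using y nt unfolding G_def by blast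
      then show ?thesis ..
    qed
  qed
  then obtain j where j: "Y \<subseteq> G j" by blast
  have "\<exists>a. \<bar>a - n\<bar> \<le> int j \<and> (\<forall>s\<ge>t + (N + j). \<forall>k. \<bar>k\<bar> \<le> r \<longrightarrow> height z (a + k) s < \<delta>)"
    if z: "z \<in> Y" "\<delta> \<le> height z n t" for z n t
  proof -
    have "z \<in> (f ^^ M) ` Y" using onto[of M] z(1) by simp
    then obtain x where x: "z = (f ^^ M) x" "x \<in> Y" by (rule imageE)
    have hz: "height z i s = height x i (s + M)" for i s
      using height_shift[OF inX[OF x(2)], of 0 M i s] x z inX by (simp add: act_0)
    let ?y = "act n ((f ^^ t) x)"
    have "?y \<in> G j" using j actY iterY x(2) by blast
    moreover have "\<not> height ?y 0 M < \<delta>"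
      using height_shift[OF inX[OF x(2)], of n t 0 M] hz[of n t] z(2) by (simp add: add.commute)
    ultimately obtain m s where m: "- int j \<le> m" "m \<le> int j"
      and ms: "s \<le> j" "act m ((f ^^ s) ?y) \<in> U"
      unfolding G_def by auto
    define u where "u = act (m + n) ((f ^^ (s + t)) x)"
    have "u = act m ((f ^^ s) ?y)"
      using inX[OF x(2)] by (simp add: u_def iter_act iter_in act_act funpow_add)
    then have u: "u \<in> A N" using ms U(3) by auto
    have "height z (m + n + k) s' < \<delta>" if "s' \<ge> t + (N + j)" "\<bar>k\<bar> \<le> r" for s' k
    proof -
      have "s' + M = s' + M - (s + t) + (s + t)" using that ms by simp
      then have "height z (m + n + k) s' = height u k (s' + M - (s + t))"
        unfolding hz u_def height_shift[OF inX[OF x(2)]] by (simp add: add.commute)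
      moreover have "N \<le> s' + M - (s + t)" using that ms by simp
      then have "height u k (s' + M - (s + t)) \<le> \<delta> / 2" using u that unfolding A_iff by simp
      ultimately show ?thesis using \<delta>_pos by simp
    qed
    then show ?thesis using m by (intro exI[of _ "m + n"]) auto
  qed
  then show ?thesis using Y by (intro exI[of _ Y] exI[of _ "int j"] exI[of _ "N + j"]) auto
qed

section \<open>Gliders\<close>

lemma isolated_points:
  assumes "undying X"
  shows "\<exists>B r. 0 \<le> r \<and> (\<forall>E S. \<exists>z\<in>X. \<exists>q. \<forall>s\<le>S. \<bar>q s\<bar> \<le> r * int s \<and> \<delta> \<le> height z (q s) s \<and>
            (\<forall>n. B \<le> \<bar>n - q s\<bar> \<and> \<bar>n - q s\<bar> \<le> E \<longrightarrow> height z n s < \<delta>))"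
proof -
  obtain r where r: "0 \<le> r" and spread: "\<And>x n t. x \<in> X \<Longrightarrow> \<delta> \<le> height x n (Suc t) \<Longrightarrow>
      \<exists>k. \<bar>k\<bar> \<le> r \<and> \<delta> \<le> height x (n + k) t"
    using radius_ex by blast
  obtain \<tau> where \<tau>: "\<And>x D a t. x \<in> X \<Longrightarrow>
      \<exists>s\<ge>t. s \<le> t + \<tau> D \<and> (\<forall>i. a \<le> i \<and> i \<le> a + D \<longrightarrow> height x i s < \<delta>)"
    using quiet_time_ex by blast
  obtain Y L C where Y: "stable Y" "undying Y" and L: "0 \<le> L"
    and walls: "\<And>z n t. z \<in> Y \<Longrightarrow> \<delta> \<le> height z n t \<Longrightarrow>
       \<exists>a. \<bar>a - n\<bar> \<le> L \<and> (\<forall>s\<ge>t + C. \<forall>k. \<bar>k\<bar> \<le> r \<longrightarrow> height z (a + k) s < \<delta>)"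
    using walls_ex[OF assms, of r] by blast
  have YX: "y \<in> X" if "y \<in> Y" for y using Y that unfolding stable_def by blast
  have st: "spacetime (\<lambda>n t. \<delta> \<le> height z n t) r L C \<tau>" if z: "z \<in> Y" for z
    using r L spread[OF YX[OF z]] walls[OF z] \<tau>[OF YX[OF z]]
    by unfold_locales (simp_all add: not_le)
  define B where "B = spacetime.margin r L C \<tau>"
  have "\<exists>z\<in>X. \<exists>q. \<forall>s\<le>S. \<bar>q s\<bar> \<le> r * int s \<and> \<delta> \<le> height z (q s) s \<and>
          (\<forall>n. B \<le> \<bar>n - q s\<bar> \<and> \<bar>n - q s\<bar> \<le> E \<longrightarrow> height z n s < \<delta>)" for E S
  proof -
    define E' where "E' = max 0 E"
    define t0 where "t0 = spacetime.start r L C \<tau> E'"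
    define T where "T = t0 + S + spacetime.remaining r L C \<tau> E'"
    \<comment> \<open>A cell live at time \<open>T\<close> has live ancestors at all earlier times; the middle part
      of this path is recentred at its cell of time \<open>t0\<close>.\<close>
    obtain z where z: "z \<in> Y" "\<Delta> < height z 0 T" using undying_height[OF Y] by blast
    interpret spacetime "\<lambda>n t. \<delta> \<le> height z n t" r L C \<tau> by (rule st[OF z(1)])
    obtain p where p: "live_path p T" using live_path_ex[of 0 T] z(2) \<delta>_less by auto
    define x where "x = act (p t0) ((f ^^ t0) z)"
    have xX: "x \<in> X" unfolding x_def using act_in iter_in YX z(1) by blast
    have hx: "height x n s = height z (n + p t0) (s + t0)" for n s
      unfolding x_def by (rule height_shift[OF YX[OF z(1)]])
    define q where "q s = p (t0 + s) - p t0" for s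
    have "\<bar>q s\<bar> \<le> r * int s \<and> \<delta> \<le> height x (q s) s \<and>
          (\<forall>n. B \<le> \<bar>n - q s\<bar> \<and> \<bar>n - q s\<bar> \<le> E \<longrightarrow> height x n s < \<delta>)" if s: "s \<le> S" for s
    proof (intro conjI allI impI)
      have le: "t0 + s \<le> T" "t0 \<le> t0 + s" "t0 + s + remaining E' \<le> T"
        using s by (auto simp: T_def)
      show "\<bar>q s\<bar> \<le> r * int s" unfolding q_def by (rule live_path_drift[OF p le(1)])
      show "\<delta> \<le> height x (q s) s"
        using p le(1) unfolding live_path_def hx q_def by (simp add: add.commute)
      show "height x n s < \<delta>" if n: "B \<le> \<bar>n - q s\<bar> \<and> \<bar>n - q s\<bar> \<le> E" for n
      proof -
        have "\<not> \<delta> \<le> height z (n + p t0) (t0 + s)"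
        proof (rule isolated[OF p _ _ le(3)])
          show "0 \<le> E'" "start E' \<le> t0 + s" using le by (auto simp: E'_def t0_def)
          show "margin \<le> \<bar>n + p t0 - p (t0 + s)\<bar>" "\<bar>n + p t0 - p (t0 + s)\<bar> \<le> E'"
            using n by (auto simp: q_def B_def E'_def algebra_simps)
        qed
        then show ?thesis by (simp add: hx add.commute)
      qed
    qed
    then show ?thesis using xX by blast
  qed
  then show ?thesis using r by blast
qed

text \<open>Being isolated up to distance \<open>j\<close> during \<open>j\<close> steps is a closed condition, for the
position \<open>q s\<close> ranges over a finite set; so points satisfying it for every \<open>j\<close> exist by
compactness. The sets \<open>W j\<close> are the complements.\<close>

lemma travelling_point:
  assumes iso: "\<And>E S. \<exists>z\<in>X. \<exists>q. \<forall>s\<le>S. \<bar>q s\<bar> \<le> r * int s \<and> \<delta> \<le> height z (q s) s \<and>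
            (\<forall>n. B \<le> \<bar>n - q s\<bar> \<and> \<bar>n - q s\<bar> \<le> E \<longrightarrow> height z n s < \<delta>)"
  shows "\<exists>c\<in>X. \<forall>s. \<exists>q. \<delta> \<le> height c q s \<and> (\<forall>n. B \<le> \<bar>n - q\<bar> \<longrightarrow> height c n s \<le> \<delta>)"
proof -
  define bad where "bad j s q x \<longleftrightarrow> height x q s < \<delta> \<or>
      (\<exists>n\<in>{n. B \<le> \<bar>n - q\<bar> \<and> \<bar>n - q\<bar> \<le> int j}. \<delta> < height x n s)" for j s q x
  define W where "W j = {x \<in> X. \<exists>s\<in>{..j}. \<forall>q\<in>{- r * int s..r * int s}. bad j s q x}" for j
  have "\<not> (\<exists>j. X \<subseteq> W j)"
  proof
    assume "\<exists>j. X \<subseteq> W j"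
    then obtain j where j: "X \<subseteq> W j" by blast
    obtain z q where z: "z \<in> X" and q: "\<And>s. s \<le> j \<Longrightarrow> \<bar>q s\<bar> \<le> r * int s \<and> \<delta> \<le> height z (q s) s \<and>
            (\<forall>n. B \<le> \<bar>n - q s\<bar> \<and> \<bar>n - q s\<bar> \<le> int j \<longrightarrow> height z n s < \<delta>)"
      using iso[of j "int j"] by blast
    obtain s where s: "s \<le> j" "\<And>q. q \<in> {- r * int s..r * int s} \<Longrightarrow> bad j s q z"
      using j z unfolding W_def by blast
    have "bad j s (q s) z" using s(2)[of "q s"] q[OF s(1)] by (simp add: abs_le_iff)
    then show False using q[OF s(1)] unfolding bad_def by (auto simp: not_less[symmetric] dest: less_asym)
  qed
  moreover have "\<exists>j. X \<subseteq> W j" if "\<And>x. x \<in> X \<Longrightarrow> \<exists>j. x \<in> W j"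
  proof (rule compact_increasing_cover[OF compact_X])
    show "openin (top_of_set X) (W j)" for j
      unfolding W_def bad_def
      by (intro openin_Bex openin_Ball_finite openin_disj openin_height_less openin_height_greater) auto
    show "W i \<subseteq> W j" if "i \<le> j" for i j
      using that unfolding W_def bad_def by fastforce
  qed (rule that)
  ultimately obtain c where c: "c \<in> X" "\<And>j. c \<notin> W j" by blast
  have "\<exists>q. \<delta> \<le> height c q s \<and> (\<forall>n. B \<le> \<bar>n - q\<bar> \<longrightarrow> height c n s \<le> \<delta>)" for s
  proof (rule ccontr)
    assume no: "\<not> ?thesis"
    let ?I = "{- r * int s..r * int s}"
    have "\<exists>j. bad j s q c" for q
    proof (cases "height c q s < \<delta>")
      case False
      then obtain n where "B \<le> \<bar>n - q\<bar>" "\<delta> < height c n s" using no by (meson not_le)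
      then have "bad (nat \<bar>n - q\<bar>) s q c" unfolding bad_def by force
      then show ?thesis ..
    qed (auto simp: bad_def)
    then obtain J where J: "\<And>q. bad (J q) s q c" by metis
    \<comment> \<open>One \<open>j\<close> that refutes all the finitely many candidate positions at once.\<close>
    define j where "j = s + (\<Sum>q\<in>?I. J q)"
    have "bad j s q c" if "q \<in> ?I" for q
    proof -
      have "J q \<le> j" unfolding j_def using that by (intro trans_le_add2 member_le_sum) auto
      then show ?thesis using J[of q] unfolding bad_def by force
    qed
    moreover have "s \<in> {..j}" by (simp add: j_def)
    ultimately have "c \<in> W j" using c(1) unfolding W_def by blast
    then show False using c(2) by blast
  qed
  then show ?thesis using c(1) by blast
qed

text \<open>Two such points that are close on the central window are within \<open>\<Delta>\<close> of each other at
every cell, so they are equal: the set has no limit point.\<close>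

lemma finite_confined:
  "finite {x \<in> X. \<delta> \<le> height x 0 0 \<and> (\<forall>n. B \<le> \<bar>n\<bar> \<longrightarrow> height x n 0 \<le> \<delta>)}" (is "finite ?F")
proof (rule ccontr)
  assume "infinite ?F"
  then obtain x where x: "x \<in> X" "x islimpt ?F"
    using Heine_Borel_imp_Bolzano_Weierstrass[OF compact_X, of ?F] by blast
  have "\<forall>n. \<exists>d>0. \<forall>y\<in>X. dist y x < d \<longrightarrow> dist (act n y) (act n x) < \<delta>"
    using act_cont x(1) \<delta>_pos unfolding continuous_on_iff by blast
  then obtain d where d: "\<And>n. 0 < d n" "\<And>n y. y \<in> X \<Longrightarrow> dist y x < d n \<Longrightarrow> dist (act n y) (act n x) < \<delta>"
    by metis
  define e where "e = Min (insert 1 (d ` {- B..B}))"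
  have "0 < e" unfolding e_def using d(1) by (subst Min_gr_iff) auto
  have e: "dist (act n y) (act n x) < \<delta>" if "y \<in> X" "dist y x < e" "\<bar>n\<bar> \<le> B" for y n
  proof -
    have "e \<le> d n" unfolding e_def using that by (intro Min_le) (auto simp: abs_le_iff)
    then show ?thesis using d(2) that by auto
  qed
  have same: "y = z" if "y \<in> ?F" "z \<in> ?F" "dist y x < e" "dist z x < e" for y z
  proof (rule separate)
    show "y \<in> X" "z \<in> X" using that by auto
    show "dist (act n y) (act n z) \<le> \<Delta>" for n
    proof (cases "B \<le> \<bar>n\<bar>")
      case True
      then have "dist (act n y) o\<^sub>X \<le> \<delta>" "dist (act n z) o\<^sub>X \<le> \<delta>"
        using that by (auto simp: height_def)
      then show ?thesis using dist_triangle2[of "act n y" "act n z" "o\<^sub>X"] by (simp add: \<delta>_def)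
    next
      case False
      then have "dist (act n y) (act n x) < \<delta>" "dist (act n z) (act n x) < \<delta>"
        using e that by auto
      then show ?thesis using dist_triangle2[of "act n y" "act n z" "act n x"] by (simp add: \<delta>_def)
    qed
  qed
  obtain y where y: "y \<in> ?F" "y \<noteq> x" "dist y x < e"
    using x(2) \<open>0 < e\<close> unfolding islimpt_approachable by blast
  have "0 < dist y x" using y(2) by simp
  then obtain z where z: "z \<in> ?F" "z \<noteq> x" "dist z x < dist y x"
    using x(2) unfolding islimpt_approachable by blast
  have "y = z" using same[OF y(1) z(1) y(3)] z(3) y(3) by linarith
  then show False using z(3) by simp
qed

text \<open>Far from the centre every window of \<open>x\<close> is small, so \<open>near_base\<close> applies to the
translates of \<open>x\<close>.\<close>

lemma confined_homoclinic:
  assumes x: "x \<in> X" "\<And>n. B \<le> \<bar>n\<bar> \<Longrightarrow> height x n 0 \<le> \<delta>"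
  shows "homoclinic X act o\<^sub>X x"
  unfolding homoclinic_def
proof (intro conjI allI impI x(1))
  fix \<epsilon> :: real assume "0 < \<epsilon>"
  let ?W = "X \<inter> ball o\<^sub>X \<epsilon>"
  have "openin (top_of_set X) ?W" by (simp add: openin_open_Int)
  moreover have "o\<^sub>X \<in> ?W" using base_in \<open>0 < \<epsilon>\<close> by simp
  ultimately obtain j where j: "j \<ge> 0" "\<And>y. y \<in> X \<Longrightarrow> (\<And>k. \<bar>k\<bar> \<le> j \<Longrightarrow> height y k 0 \<le> \<delta>) \<Longrightarrow> y \<in> ?W"
    using near_base[of ?W] by blast
  have "dist (act n x) o\<^sub>X < \<epsilon>" if n: "n \<notin> {- (\<bar>B\<bar> + j)..\<bar>B\<bar> + j}" for n
  proof -
    have "height (act n x) k 0 \<le> \<delta>" if "\<bar>k\<bar> \<le> j" for k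
    proof -
      have "B \<le> \<bar>k + n\<bar>" using n that by auto
      then show ?thesis using x(2) height_shift[OF x(1), of n 0 k 0] by simp
    qed
    then have "act n x \<in> ?W" using j(2) act_in x(1) by blast
    then show ?thesis by (simp add: dist_commute)
  qed
  then show "\<exists>E. finite E \<and> (\<forall>n. n \<notin> E \<longrightarrow> dist (act n x) o\<^sub>X < \<epsilon>)" by blast
qed

text \<open>The images of \<open>c\<close>, recentred, all lie in the finite set of \<open>finite_confined\<close>, so two of
them coincide.\<close>

lemma glider_ex:
  assumes c: "c \<in> X"
    and conf: "\<And>s. \<exists>q. \<delta> \<le> height c q s \<and> (\<forall>n. B \<le> \<bar>n - q\<bar> \<longrightarrow> height c n s \<le> \<delta>)"
  shows "\<exists>g p q. homoclinic X act o\<^sub>X g \<and> g \<noteq> o\<^sub>X \<and> 0 < p \<and> (f ^^ p) g = act q g"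
proof -
  obtain q where q: "\<And>s. \<delta> \<le> height c (q s) s"
    "\<And>s n. B \<le> \<bar>n - q s\<bar> \<Longrightarrow> height c n s \<le> \<delta>" using conf by metis
  define h where "h s = act (q s) ((f ^^ s) c)" for s
  have hX: "h s \<in> X" for s unfolding h_def by (intro act_in iter_in c)
  have hh: "height (h s) n 0 = height c (n + q s) s" for s n
    unfolding h_def using height_shift[OF c, of "q s" s n 0] by simp
  have hB: "height (h s) n 0 \<le> \<delta>" if "B \<le> \<bar>n\<bar>" for s n
    unfolding hh using q(2)[of "n + q s" s] that by simp
  have "range h \<subseteq> {x \<in> X. \<delta> \<le> height x 0 0 \<and> (\<forall>n. B \<le> \<bar>n\<bar> \<longrightarrow> height x n 0 \<le> \<delta>)}"
    using hX hB hh q(1) by auto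
  then have "finite (range h)" using finite_confined finite_subset by blast
  then have "\<not> inj h" using finite_imageD infinite_UNIV_nat by blast
  then obtain s s' where ss: "s < s'" "h s = h s'" unfolding inj_def by (metis linorder_neqE_nat)
  define p where "p = s' - s"
  have "act (q s) ((f ^^ s) c) = act (q s') ((f ^^ (p + s)) c)"
    using ss unfolding h_def p_def by simp
  then have "act (- q s') (act (q s) ((f ^^ s) c)) = act (- q s') (act (q s') ((f ^^ (p + s)) c))"
    by simp
  then have eq: "(f ^^ p) ((f ^^ s) c) = act (q s - q s') ((f ^^ s) c)"
    using c by (simp add: act_act iter_in act_0 funpow_add)
  have "(f ^^ p) (h s) = act (q s - q s') (h s)"
    using eq c unfolding h_def by (simp add: iter_act iter_in act_act add.commute)
  moreover have "h s \<noteq> o\<^sub>X"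
  proof
    assume "h s = o\<^sub>X"
    then have "height (h s) 0 0 = 0" by (simp add: height_def)
    then show False using hh[of s 0] q(1)[of s] \<delta>_pos by simp
  qed
  moreover have "homoclinic X act o\<^sub>X (h s)" by (rule confined_homoclinic[OF hX hB])
  ultimately show ?thesis using ss(1) unfolding p_def by (metis zero_less_diff)
qed

section \<open>Points that follow a glider\<close>

text \<open>Near each cell, \<open>x\<close> looks like a translate of \<open>g\<close>, on which \<open>f\<^sup>p\<close> and the translation by
\<open>q\<close> agree. So their values at \<open>x\<close> are within \<open>\<Delta>\<close> of each other at every cell.\<close>

lemma fellow_traveller:
  assumes g: "g \<in> X" "(f ^^ p) g = act q g"
  shows "\<exists>\<epsilon>>0. \<forall>x\<in>X. (\<forall>n. \<exists>k. dist (act n x) (act k g) < \<epsilon>) \<longrightarrow> (f ^^ p) x = act q x"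
proof -
  have "uniformly_continuous_on X (f ^^ p)" "uniformly_continuous_on X (act q)"
    using compact_uniformly_continuous compact_X iter_cont act_cont by blast+
  then obtain d e where d: "0 < d" "\<And>x y. x \<in> X \<Longrightarrow> y \<in> X \<Longrightarrow> dist y x < d \<Longrightarrow> dist ((f ^^ p) y) ((f ^^ p) x) < \<delta>"
    and e: "0 < e" "\<And>x y. x \<in> X \<Longrightarrow> y \<in> X \<Longrightarrow> dist y x < e \<Longrightarrow> dist (act q y) (act q x) < \<delta>"
    using \<delta>_pos unfolding uniformly_continuous_on_def by metis
  have "(f ^^ p) x = act q x" if x: "x \<in> X" and sh: "\<And>n. \<exists>k. dist (act n x) (act k g) < min d e" for x
  proof (rule separate)
    show "(f ^^ p) x \<in> X" "act q x \<in> X" using x iter_in act_in by blast+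
    fix n
    obtain k where k: "dist (act n x) (act k g) < min d e" using sh by blast
    have "dist ((f ^^ p) (act n x)) ((f ^^ p) (act k g)) < \<delta>" using d(2) k act_in x g(1) by simp
    moreover have "dist (act q (act n x)) (act q (act k g)) < \<delta>" using e(2) k act_in x g(1) by simp
    moreover have "(f ^^ p) (act k g) = act q (act k g)"
      using g by (simp add: iter_act act_act add.commute)
    moreover have "(f ^^ p) (act n x) = act n ((f ^^ p) x)" using x by (rule iter_act)
    moreover have "act q (act n x) = act n (act q x)" using x by (simp add: act_act add.commute)
    ultimately have "dist (act n ((f ^^ p) x)) (act q (act k g)) < \<delta>"
      "dist (act n (act q x)) (act q (act k g)) < \<delta>" by simp_all
    then show "dist (act n ((f ^^ p) x)) (act n (act q x)) \<le> \<Delta>"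
      using dist_triangle2[of "act n ((f ^^ p) x)" "act n (act q x)" "act q (act k g)"]
      by (simp add: \<delta>_def)
  qed
  then show ?thesis using d(1) e(1) by (intro exI[of _ "min d e"]) auto
qed

lemma iter_travel:
  assumes x: "x \<in> X" "(f ^^ p) x = act q x"
  shows "(f ^^ (p * j)) x = act (q * int j) x"
proof (induction j)
  case 0
  then show ?case using x by (simp add: act_0)
next
  case (Suc j)
  have "(f ^^ (p * Suc j)) x = (f ^^ p) ((f ^^ (p * j)) x)" by (simp add: funpow_add)
  also have "\<dots> = act (q * int j) ((f ^^ p) x)" unfolding Suc using x(1) by (rule iter_act)
  also have "\<dots> = act (q * int (Suc j)) x" using x by (simp add: act_act algebra_simps)
  finally show ?case .
qed

text \<open>Dividing \<open>n\<close> by \<open>q\<close> shows that cell \<open>n\<close> of \<open>x\<close> is cell \<open>n mod q\<close> of \<open>f\<^sup>m x\<close> with \<open>m = p *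
(n div q)\<close>. Only finitely many residues occur, and at each of them the orbit of \<open>x\<close> tends to
the fixed point.\<close>

lemma travel_escapes:
  assumes x: "x \<in> X" "(f ^^ p) x = act q x" and p: "0 < p" and q: "q \<noteq> 0" and \<epsilon>: "0 < \<epsilon>"
  shows "finite {n. 0 < n * q \<and> \<epsilon> \<le> dist (act n x) o\<^sub>X}"
proof -
  obtain T where T: "\<And>t n. T \<le> t \<Longrightarrow> n \<in> {- \<bar>q\<bar>..\<bar>q\<bar>} \<Longrightarrow> height x n t < \<epsilon>"
    using height_eventually[OF x(1) finite_atLeastAtMost_int \<epsilon>] by metis
  have "\<bar>n\<bar> \<le> \<bar>q\<bar> * (int T + 1)" if n: "0 < n * q" "\<epsilon> \<le> dist (act n x) o\<^sub>X" for n
  proof (rule ccontr)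
    assume "\<not> ?thesis"
    then have big: "\<bar>q\<bar> * (int T + 1) < \<bar>n\<bar>" by simp
    define m where "m = n div q"
    have n_eq: "n = q * m + n mod q" unfolding m_def by simp
    have mod: "\<bar>n mod q\<bar> < \<bar>q\<bar>" using q by (rule abs_mod_less)
    have m0: "0 \<le> m"
      using n(1) unfolding m_def by (auto simp: zero_less_mult_iff pos_imp_zdiv_nonneg_iff neg_imp_zdiv_nonneg_iff)
    have "\<bar>n\<bar> \<le> \<bar>q * m\<bar> + \<bar>n mod q\<bar>" using n_eq abs_triangle_ineq by metis
    then have "\<bar>q\<bar> * (int T + 1) < \<bar>q\<bar> * m + \<bar>q\<bar>" using big mod m0 by (simp add: abs_mult)
    then have "\<bar>q\<bar> * (int T + 1) < \<bar>q\<bar> * (m + 1)" by (simp add: algebra_simps)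
    then have "int T < m" by (simp add: mult_less_cancel_left)
    then have "T \<le> nat m" by simp
    also have "nat m \<le> p * nat m" using p by simp
    finally have "height x (n mod q) (p * nat m) < \<epsilon>" using T mod by (auto simp: abs_less_iff)
    moreover have "act (n mod q) ((f ^^ (p * nat m)) x) = act n x"
      unfolding iter_travel[OF x] using x(1) m0 n_eq by (simp add: act_act add.commute)
    ultimately show False using n(2) by (simp add: height_def)
  qed
  then have "{n. 0 < n * q \<and> \<epsilon> \<le> dist (act n x) o\<^sub>X} \<subseteq> {- (\<bar>q\<bar> * (int T + 1))..\<bar>q\<bar> * (int T + 1)}"
    unfolding abs_le_iff by fastforce
  then show ?thesis using finite_subset by blast
qed

lemma undying_glider:
  assumes "undying X"
  shows "\<exists>g p q. homoclinic X act o\<^sub>X g \<and> g \<noteq> o\<^sub>X \<and> 0 < p \<and> (f ^^ p) g = act q g"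
proof -
  obtain B r where iso: "\<And>E S. \<exists>z\<in>X. \<exists>q. \<forall>s\<le>S. \<bar>q s\<bar> \<le> r * int s \<and> \<delta> \<le> height z (q s) s \<and>
      (\<forall>n. B \<le> \<bar>n - q s\<bar> \<and> \<bar>n - q s\<bar> \<le> E \<longrightarrow> height z n s < \<delta>)"
    using isolated_points[OF assms] by blast
  obtain c where "c \<in> X" "\<And>s. \<exists>q. \<delta> \<le> height c q s \<and> (\<forall>n. B \<le> \<bar>n - q\<bar> \<longrightarrow> height c n s \<le> \<delta>)"
    using travelling_point[OF iso] by blast
  then show ?thesis by (rule glider_ex)
qed

text \<open>A glider with \<open>q = 0\<close> would be periodic under \<open>f\<close>. Otherwise \<open>x1\<close> or \<open>x2\<close>, according to
the sign of \<open>q\<close>, returns close to \<open>g\<close> infinitely often on the side on which \<open>travel_escapes\<close>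
makes it tend to the fixed point.\<close>

lemma not_undying:
  assumes glue: "\<And>x \<epsilon>. homoclinic X act o\<^sub>X x \<Longrightarrow> \<epsilon> > 0 \<Longrightarrow>
           \<exists>x1\<in>X. \<exists>x2\<in>X.
             (\<forall>n. \<exists>k. dist (act n x1) (act k x) < \<epsilon>) \<and>
             (\<forall>n. \<exists>k. dist (act n x2) (act k x) < \<epsilon>) \<and>
             infinite {n. n > 0 \<and> dist (act n x1) x < \<epsilon>} \<and>
             infinite {n. n < 0 \<and> dist (act n x2) x < \<epsilon>}"
  shows "\<not> undying X"
proof
  assume "undying X"
  then obtain g p q where g: "homoclinic X act o\<^sub>X g" "g \<noteq> o\<^sub>X" and p: "0 < p"
    and gp: "(f ^^ p) g = act q g"
    using undying_glider by blast
  have gX: "g \<in> X" using g(1) unfolding homoclinic_def by blast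
  have "q \<noteq> 0"
  proof
    assume "q = 0"
    then have fixed: "(f ^^ (p * j)) g = g" for j
      using iter_travel[OF gX gp] gX by (simp add: act_0)
    have "0 < dist g o\<^sub>X" using g(2) by simp
    then obtain T where T: "\<And>t. T \<le> t \<Longrightarrow> height g 0 t < dist g o\<^sub>X"
      using height_eventually[OF gX, of "{0}"] by blast
    have "T \<le> p * T" using p by simp
    from T[OF this] show False using height_0[OF gX] fixed by simp
  qed
  obtain \<eta> where \<eta>: "0 < \<eta>" "\<And>x. x \<in> X \<Longrightarrow> (\<And>n. \<exists>k. dist (act n x) (act k g) < \<eta>) \<Longrightarrow> (f ^^ p) x = act q x"
    using fellow_traveller[OF gX gp] by blast
  define \<epsilon> where "\<epsilon> = min \<eta> (dist g o\<^sub>X / 2)"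
  have \<epsilon>: "0 < \<epsilon>" "\<epsilon> \<le> \<eta>" "2 * \<epsilon> \<le> dist g o\<^sub>X" using \<eta>(1) g(2) by (auto simp: \<epsilon>_def)
  have finite: "finite {n. 0 < n * q \<and> dist (act n x) g < \<epsilon>}"
    if x: "x \<in> X" and near: "\<forall>n. \<exists>k. dist (act n x) (act k g) < \<epsilon>" for x
  proof -
    have "(f ^^ p) x = act q x" using \<eta>(2)[OF x] near \<epsilon>(2) by (meson less_le_trans)
    then have "finite {n. 0 < n * q \<and> \<epsilon> \<le> dist (act n x) o\<^sub>X}"
      by (rule travel_escapes[OF x _ p \<open>q \<noteq> 0\<close> \<epsilon>(1)])
    moreover have "\<epsilon> \<le> dist (act n x) o\<^sub>X" if "dist (act n x) g < \<epsilon>" for n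
      using dist_triangle3[of g "o\<^sub>X" "act n x"] that \<epsilon>(3) by simp
    ultimately show ?thesis by (auto elim!: rev_finite_subset)
  qed
  obtain x1 x2 where x: "x1 \<in> X" "x2 \<in> X"
    "\<forall>n. \<exists>k. dist (act n x1) (act k g) < \<epsilon>" "\<forall>n. \<exists>k. dist (act n x2) (act k g) < \<epsilon>"
    and inf: "infinite {n. n > 0 \<and> dist (act n x1) g < \<epsilon>}"
      "infinite {n. n < 0 \<and> dist (act n x2) g < \<epsilon>}"
    using glue[OF g(1) \<epsilon>(1)] by blast
  show False
  proof (cases "0 < q")
    case True
    then have "{n. n > 0 \<and> dist (act n x1) g < \<epsilon>} = {n. 0 < n * q \<and> dist (act n x1) g < \<epsilon>}"
      by (auto simp: zero_less_mult_iff)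
    then show False using inf(1) finite[OF x(1,3)] by simp
  next
    case False
    then have "{n. n < 0 \<and> dist (act n x2) g < \<epsilon>} = {n. 0 < n * q \<and> dist (act n x2) g < \<epsilon>}"
      using \<open>q \<noteq> 0\<close> by (auto simp: zero_less_mult_iff)
    then show False using inf(2) finite[OF x(2,4)] by simp
  qed
qed

end

theorem mainTheorem3:
  fixes X :: "'a::metric_space set"
    and act :: "int \<Rightarrow> 'a \<Rightarrow> 'a"
    and o\<^sub>X :: 'a
  assumes "pointed_Z_system X act o\<^sub>X"
    and "expansive X act"
    and "\<And>x \<epsilon>. homoclinic X act o\<^sub>X x \<Longrightarrow> \<epsilon> > 0 \<Longrightarrow>
           \<exists>x1\<in>X. \<exists>x2\<in>X.
             (\<forall>n. \<exists>k. dist (act n x1) (act k x) < \<epsilon>) \<and>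
             (\<forall>n. \<exists>k. dist (act n x2) (act k x) < \<epsilon>) \<and>
             infinite {n. n > 0 \<and> dist (act n x1) x < \<epsilon>} \<and>
             infinite {n. n < 0 \<and> dist (act n x2) x < \<epsilon>}"
  shows "\<forall>f. endomorphism X act o\<^sub>X f \<and> asymptotically_nilpotent X o\<^sub>X f \<longrightarrow> nilpotent X o\<^sub>X f"
proof (intro allI impI)
  fix f assume f: "endomorphism X act o\<^sub>X f \<and> asymptotically_nilpotent X o\<^sub>X f"
  obtain \<Delta> where "0 < \<Delta>"
    "\<And>x y. x \<in> X \<Longrightarrow> y \<in> X \<Longrightarrow> (\<And>n. dist (act n x) (act n y) \<le> \<Delta>) \<Longrightarrow> x = y"
    using assms(2) unfolding expansive_def by blast
  then interpret nil_endo X act "o\<^sub>X" f \<Delta>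
    using assms(1) f by unfold_locales auto
  have "\<not> undying X" using not_undying[OF assms(3)] .
  then obtain M where "\<And>x. x \<in> X \<Longrightarrow> (f ^^ M) x = o\<^sub>X" unfolding undying_def by blast
  then have "(f ^^ M) ` X = {o\<^sub>X}" using base_in by force
  then show "nilpotent X o\<^sub>X f" unfolding nilpotent_def by blast
qed

end
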